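(* Let $\mathcal{K}$ be an algebraically closed field, and let $f_1,\dots,f_L\in\mathcal{K}[x_1,\dots,x_S]$ be polynomials of the form $f_i=\sum_{j=1}^{S}h_{ij}x_j+g_i$, where $h_{ij}\in\mathcal{K}$ and each $g_i$ is a polynomial consisting only of terms of degree no less than $2$. If the coefficient vectors $\mathbf{h}_i=[h_{i1},h_{i2},\dots,h_{iS}]$, $i\in\{1,\dots,L\}$, are linearly independent, then the polynomials $f_1,\dots,f_L$ are algebraically independent over $\mathcal{K}$.
   Context: Polynomials $f_1,\dots,f_L$ are algebraically independent over $\mathcal{K}$ if there is no nonzero polynomial $p$ in $L$ variables with coefficients in $\mathcal{K}$ such that $p(f_1,\dots,f_L)=0$. *)

theory Defs
  imports
    "HOL-Analysis.Analysis"
    "HOL-Computational_Algebra.Polynomial"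
    "HOL-Library.Poly_Mapping"
begin

text \<open>
  Polynomials over \<open>'a\<close> in variables indexed by \<open>'v\<close>, as the monoid algebra over exponent vectors:
  ring operations are those of \<^theory>\<open>HOL-Library.Poly_Mapping\<close>, multiplication being convolution.
\<close>

type_synonym ('v, 'a) mpoly = "('v \<Rightarrow>\<^sub>0 nat) \<Rightarrow>\<^sub>0 'a"

definition mpoly_const :: "'a \<Rightarrow> ('v, 'a::comm_ring_1) mpoly" where
  "mpoly_const c = Poly_Mapping.single 0 c"

definition mpoly_var :: "'v \<Rightarrow> ('v, 'a::comm_ring_1) mpoly" where
  "mpoly_var x = Poly_Mapping.single (Poly_Mapping.single x 1) 1"

definition monomial_degree :: "('v \<Rightarrow>\<^sub>0 nat) \<Rightarrow> nat" where
  "monomial_degree m = (\<Sum>x\<in>Poly_Mapping.keys m. Poly_Mapping.lookup m x)"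

definition mpoly_subst ::
    "('w \<Rightarrow> ('v, 'a::comm_ring_1) mpoly) \<Rightarrow> ('w, 'a) mpoly \<Rightarrow> ('v, 'a) mpoly" where
  "mpoly_subst f p =
     (\<Sum>m\<in>Poly_Mapping.keys p. mpoly_const (Poly_Mapping.lookup p m) *
        (\<Prod>i\<in>Poly_Mapping.keys m. f i ^ Poly_Mapping.lookup m i))"

definition algebraically_independent :: "('w \<Rightarrow> ('v, 'a::field) mpoly) \<Rightarrow> bool" where
  "algebraically_independent f \<longleftrightarrow> \<not> (\<exists>p :: ('w, 'a) mpoly. p \<noteq> 0 \<and> mpoly_subst f p = 0)"

text \<open>
  Independence of \<^const>\<open>vec.dependent\<close> is a property of sets; for a family, repeated vectors must
  be excluded separately.
\<close>

definition linearly_independent_family :: "('i \<Rightarrow> 'a::field ^ 'n) \<Rightarrow> bool" where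
  "linearly_independent_family v \<longleftrightarrow> inj v \<and> vec.independent (range v)"

end

theory Submission
  imports Defs
begin

(* Multiply the coefficient matrix h by a right inverse: the corresponding linear substitution turns
   each f i into y_i plus terms of degree at least 2. Then the monomial m(f) is m plus terms of
   degree larger than that of m, so a monomial of least degree in p keeps its coefficient in p(f). *)

section \<open>Additivity of the total degree\<close>

text \<open>Indices outside the support contribute 0, so two exponent vectors can be summed over a
  common index set.\<close>

lemma monomial_degree_eq_sum:
  assumes "finite A" "Poly_Mapping.keys m \<subseteq> A"
  shows "monomial_degree m = (\<Sum>x\<in>A. Poly_Mapping.lookup m x)"
  unfolding monomial_degree_def
  using assms by (intro sum.mono_neutral_left) (auto simp: in_keys_iff)

lemma monomial_degree_add: "monomial_degree (m + n) = monomial_degree m + monomial_degree n"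
proof -
  let ?A = "Poly_Mapping.keys m \<union> Poly_Mapping.keys n"
  have "Poly_Mapping.keys (m + n) \<subseteq> ?A"
    by (rule keys_add)
  then show ?thesis
    by (simp add: monomial_degree_eq_sum[of ?A] lookup_add sum.distrib)
qed

lemma monomial_degree_0 [simp]: "monomial_degree 0 = 0"
  by (simp add: monomial_degree_def)

lemma monomial_degree_single [simp]: "monomial_degree (Poly_Mapping.single x k) = k"
  by (simp add: monomial_degree_def)


subsection \<open>Order of vanishing at the origin\<close>

text \<open>Membership in the \<open>k\<close>-th power of the ideal generated by the variables. The
  zero polynomial satisfies it for every \<open>k\<close>.\<close>

definition order_ge :: "nat \<Rightarrow> ('v, 'a::comm_ring_1) mpoly \<Rightarrow> bool" where
  "order_ge k p \<longleftrightarrow> (\<forall>m\<in>Poly_Mapping.keys p. k \<le> monomial_degree m)"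

lemma order_ge_0 [simp]: "order_ge 0 p"
  by (simp add: order_ge_def)

lemma order_ge_zero [simp]: "order_ge k 0"
  by (simp add: order_ge_def)

lemma order_ge_mono: "order_ge k p \<Longrightarrow> l \<le> k \<Longrightarrow> order_ge l p"
  by (force simp: order_ge_def)

lemma order_ge_add: "order_ge k p \<Longrightarrow> order_ge k q \<Longrightarrow> order_ge k (p + q)"
  using keys_add[of p q] by (auto simp: order_ge_def)

lemma order_ge_sum: "(\<And>x. x \<in> A \<Longrightarrow> order_ge k (p x)) \<Longrightarrow> order_ge k (sum p A)"
  by (induction A rule: infinite_finite_induct) (auto intro: order_ge_add)

lemma order_ge_mult: "order_ge k p \<Longrightarrow> order_ge l q \<Longrightarrow> order_ge (k + l) (p * q)"
  using keys_mult[of p q] by (fastforce simp: order_ge_def monomial_degree_add intro: add_mono)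

lemma order_ge_mult_left: "order_ge l q \<Longrightarrow> order_ge l (p * q)"
  using order_ge_mult[of 0 p l q] by simp

lemma order_ge_power: "order_ge k p \<Longrightarrow> order_ge (n * k) (p ^ n)"
  by (induction n) (auto intro: order_ge_mult)

lemma order_ge_prod:
  "(\<And>x. x \<in> A \<Longrightarrow> order_ge (k x) (p x)) \<Longrightarrow> order_ge (sum k A) (prod p A)"
  by (induction A rule: infinite_finite_induct) (auto intro: order_ge_mult)

lemma order_ge_var: "order_ge 1 (mpoly_var x)"
  by (simp add: order_ge_def mpoly_var_def)

text \<open>Congruence modulo terms of degree above \<open>k\<close> between polynomials of order at
  least \<open>k\<close>. Only order bounds enter: \<open>q\<close> may be zero or
  inhomogeneous.\<close>

definition leading_part :: "nat \<Rightarrow> ('v, 'a::comm_ring_1) mpoly \<Rightarrow> ('v, 'a) mpoly \<Rightarrow> bool" where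
  "leading_part k p q \<longleftrightarrow> order_ge k q \<and> order_ge (Suc k) (p - q)"

lemma leading_part_one: "leading_part 0 1 1"
  by (simp add: leading_part_def)

text \<open>The error splits as \<open>(p - q) * p' + q * (p' - q')\<close>; in each summand the
  difference raises the order by one.\<close>

lemma leading_part_mult:
  assumes "leading_part k p q" "leading_part l p' q'"
  shows "leading_part (k + l) (p * p') (q * q')"
proof -
  have q: "order_ge k q" "order_ge l q'"
    and d: "order_ge (Suc k) (p - q)" "order_ge (Suc l) (p' - q')"
    using assms by (auto simp: leading_part_def)
  \<comment> \<open>Write \<open>p'\<close> as \<open>(p' - q') + q'\<close>, both of order at least
    \<open>l\<close>.\<close>
  have "order_ge l p'"
    using order_ge_add[OF order_ge_mono[OF d(2), of l] q(2)] by simp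
  then have "order_ge (Suc (k + l)) ((p - q) * p')"
    using order_ge_mult[OF d(1)] by simp
  moreover have "order_ge (Suc (k + l)) (q * (p' - q'))"
    using order_ge_mult[OF q(1) d(2)] by simp
  ultimately have "order_ge (Suc (k + l)) ((p - q) * p' + q * (p' - q'))"
    by (rule order_ge_add)
  moreover have "(p - q) * p' + q * (p' - q') = p * p' - q * q'"
    by (simp add: algebra_simps)
  ultimately show ?thesis
    using order_ge_mult[OF q] by (simp add: leading_part_def)
qed

lemma leading_part_power: "leading_part k p q \<Longrightarrow> leading_part (n * k) (p ^ n) (q ^ n)"
  by (induction n) (auto intro: leading_part_mult leading_part_one)

lemma leading_part_prod:
  "(\<And>x. x \<in> A \<Longrightarrow> leading_part (k x) (p x) (q x)) \<Longrightarrow>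
    leading_part (sum k A) (prod p A) (prod q A)"
  by (induction A rule: infinite_finite_induct)
    (auto intro: leading_part_mult leading_part_one)


subsection \<open>Substitution is a ring homomorphism\<close>

definition monomial_subst ::
    "('w \<Rightarrow> ('v, 'a::comm_ring_1) mpoly) \<Rightarrow> ('w \<Rightarrow>\<^sub>0 nat) \<Rightarrow> ('v, 'a) mpoly" where
  "monomial_subst f m = (\<Prod>i\<in>Poly_Mapping.keys m. f i ^ Poly_Mapping.lookup m i)"

lemma monomial_subst_eq_prod:
  assumes "finite A" "Poly_Mapping.keys m \<subseteq> A"
  shows "monomial_subst f m = (\<Prod>i\<in>A. f i ^ Poly_Mapping.lookup m i)"
  unfolding monomial_subst_def
  using assms by (intro prod.mono_neutral_left) (auto simp: in_keys_iff)

lemma monomial_subst_add: "monomial_subst f (m + n) = monomial_subst f m * monomial_subst f n"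
proof -
  let ?A = "Poly_Mapping.keys m \<union> Poly_Mapping.keys n"
  have "Poly_Mapping.keys (m + n) \<subseteq> ?A"
    by (rule keys_add)
  then show ?thesis
    by (simp add: monomial_subst_eq_prod[of ?A] lookup_add power_add prod.distrib)
qed

lemma poly_mapping_sum_singles:
  "(\<Sum>x\<in>Poly_Mapping.keys p. Poly_Mapping.single x (Poly_Mapping.lookup p x)) = p"
  by (rule poly_mapping_eqI) (simp add: lookup_sum lookup_single when_def in_keys_iff)

lemma monomial_subst_var: "monomial_subst mpoly_var m = Poly_Mapping.single m 1"
proof -
  have pow: "(mpoly_var i :: ('a, 'b) mpoly) ^ n =
      Poly_Mapping.single (Poly_Mapping.single i n) 1" for i n
    by (induction n) (simp_all add: mpoly_var_def mult_single flip: single_add)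
  \<comment> \<open>An arbitrary finite \<open>A\<close> replaces the support of \<open>m\<close>,
    so that \<open>m\<close> stays fixed during the induction.\<close>
  have "(\<Prod>i\<in>A. Poly_Mapping.single (Poly_Mapping.single i (Poly_Mapping.lookup m i)) (1::'b)) =
      Poly_Mapping.single (\<Sum>i\<in>A. Poly_Mapping.single i (Poly_Mapping.lookup m i)) 1"
    if "finite A" for A
    using that by induction (simp_all add: mult_single)
  then show ?thesis
    by (simp add: monomial_subst_def pow poly_mapping_sum_singles)
qed

lemma mpoly_const_add: "mpoly_const (c + d) = mpoly_const c + mpoly_const d"
  by (simp add: mpoly_const_def single_add)

lemma mpoly_const_mult: "mpoly_const (c * d) = mpoly_const c * mpoly_const d"
  by (simp add: mpoly_const_def mult_single)

lemma mpoly_const_0 [simp]: "mpoly_const 0 = 0"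
  by (simp add: mpoly_const_def)

lemma mpoly_const_1 [simp]: "mpoly_const 1 = 1"
  by (simp add: mpoly_const_def)

lemma mpoly_const_sum: "mpoly_const (sum c A) = (\<Sum>x\<in>A. mpoly_const (c x))"
  by (induction A rule: infinite_finite_induct) (simp_all add: mpoly_const_add)

lemma mpoly_subst_eq_sum:
  assumes "finite A" "Poly_Mapping.keys p \<subseteq> A"
  shows "mpoly_subst f p = (\<Sum>m\<in>A. mpoly_const (Poly_Mapping.lookup p m) * monomial_subst f m)"
  unfolding mpoly_subst_def monomial_subst_def
  using assms by (intro sum.mono_neutral_left) (auto simp: in_keys_iff)

lemma mpoly_subst_add: "mpoly_subst f (p + q) = mpoly_subst f p + mpoly_subst f q"
proof -
  let ?A = "Poly_Mapping.keys p \<union> Poly_Mapping.keys q"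
  have "Poly_Mapping.keys (p + q) \<subseteq> ?A"
    by (rule keys_add)
  then show ?thesis
    by (simp add: mpoly_subst_eq_sum[of ?A] lookup_add mpoly_const_add distrib_right sum.distrib)
qed

lemma mpoly_subst_single:
  "mpoly_subst f (Poly_Mapping.single m c) = mpoly_const c * monomial_subst f m"
  by (simp add: mpoly_subst_eq_sum[of "{m}"])

lemma mpoly_subst_0 [simp]: "mpoly_subst f 0 = 0"
  by (simp add: mpoly_subst_def)

lemma mpoly_subst_const: "mpoly_subst f (mpoly_const c) = mpoly_const c"
  by (simp add: mpoly_const_def[of c] mpoly_subst_single monomial_subst_def)

lemma mpoly_subst_1 [simp]: "mpoly_subst f 1 = 1"
  using mpoly_subst_const[of f 1] by simp

lemma mpoly_subst_var: "mpoly_subst f (mpoly_var x) = f x"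
  by (simp add: mpoly_var_def mpoly_subst_single monomial_subst_def)

lemma mpoly_subst_sum: "mpoly_subst f (sum p A) = (\<Sum>x\<in>A. mpoly_subst f (p x))"
  by (induction A rule: infinite_finite_induct) (simp_all add: mpoly_subst_add)

text \<open>Expanding both factors into single terms (\<open>?S\<close> is the identity in that
  form) reduces the claim to products of single terms, whose exponent vectors add.\<close>

lemma mpoly_subst_mult: "mpoly_subst f (p * q) = mpoly_subst f p * mpoly_subst f q"
proof -
  let ?S = "\<lambda>p. \<Sum>m\<in>Poly_Mapping.keys p. Poly_Mapping.single m (Poly_Mapping.lookup p m)"
  have "mpoly_subst f (?S p * ?S q) = mpoly_subst f (?S p) * mpoly_subst f (?S q)"
    unfolding sum_product mpoly_subst_sum
    by (simp add: mult_single mpoly_subst_single monomial_subst_add mpoly_const_mult mult_ac)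
  then show ?thesis
    by (simp only: poly_mapping_sum_singles)
qed

lemma mpoly_subst_power: "mpoly_subst f (p ^ n) = mpoly_subst f p ^ n"
  by (induction n) (simp_all add: mpoly_subst_mult)

lemma mpoly_subst_prod: "mpoly_subst f (prod p A) = (\<Prod>x\<in>A. mpoly_subst f (p x))"
  by (induction A rule: infinite_finite_induct) (simp_all add: mpoly_subst_mult)

lemma mpoly_subst_mpoly_subst:
  "mpoly_subst e (mpoly_subst f p) = mpoly_subst (\<lambda>i. mpoly_subst e (f i)) p"
  \<comment> \<open>Only the substitutions by \<open>f\<close> and by the composed family are
    unfolded; the one by \<open>e\<close> stays folded and is pushed inward as a ring homomorphism
    fixing constants.\<close>
  by (simp add: mpoly_subst_def[of f] mpoly_subst_def[of "\<lambda>i. mpoly_subst e (f i)"]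
      mpoly_subst_sum mpoly_subst_mult mpoly_subst_const mpoly_subst_prod mpoly_subst_power)

text \<open>Each factor \<open>f i\<close> has no constant term, so a monomial of degree
  \<open>d\<close> becomes a product of order at least \<open>d\<close>.\<close>

lemma order_ge_mpoly_subst:
  assumes "\<And>i. order_ge 1 (f i)" "order_ge k p"
  shows "order_ge k (mpoly_subst f p)"
  unfolding mpoly_subst_def
proof (intro order_ge_sum order_ge_mult_left)
  fix m assume m: "m \<in> Poly_Mapping.keys p"
  have "order_ge (monomial_degree m) (\<Prod>i\<in>Poly_Mapping.keys m. f i ^ Poly_Mapping.lookup m i)"
    unfolding monomial_degree_def
    using order_ge_power[OF assms(1)] by (intro order_ge_prod) simp
  then show "order_ge k (\<Prod>i\<in>Poly_Mapping.keys m. f i ^ Poly_Mapping.lookup m i)"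
    by (rule order_ge_mono) (use assms(2) m in \<open>simp add: order_ge_def\<close>)
qed


subsection \<open>Algebraic independence\<close>

lemma algebraically_independent_of_leading_vars:
  fixes f :: "'w \<Rightarrow> ('w, 'a::field) mpoly"
  assumes "\<And>i. order_ge 2 (f i - mpoly_var i)"
  shows "algebraically_independent f"
  unfolding algebraically_independent_def
proof (rule notI, elim exE conjE)
  fix p :: "('w, 'a) mpoly"
  assume p: "p \<noteq> 0" and zero: "mpoly_subst f p = 0"
  let ?K = "Poly_Mapping.keys p"
  obtain m where m: "m \<in> ?K" and least: "\<And>n. n \<in> ?K \<Longrightarrow> monomial_degree m \<le> monomial_degree n"
  proof
    have nonempty: "?K \<noteq> {}"
      using p by (auto intro: poly_mapping_eqI simp: in_keys_iff)
    then show "arg_min_on monomial_degree ?K \<in> ?K"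
      by (intro arg_min_if_finite(1)) simp_all
    show "monomial_degree (arg_min_on monomial_degree ?K) \<le> monomial_degree n" if "n \<in> ?K" for n
      using nonempty that by (intro arg_min_least) simp_all
  qed
  \<comment> \<open>Each \<open>f i\<close> agrees with its variable up to terms of degree at least
    2; multiplying these congruences gives the one for the monomial \<open>n\<close>.\<close>
  have lead: "leading_part (monomial_degree n) (monomial_subst f n) (Poly_Mapping.single n 1)" for n
  proof -
    have "leading_part 1 (f i) (mpoly_var i)" for i
      using assms[of i] order_ge_var by (simp add: leading_part_def numeral_2_eq_2)
    from leading_part_power[OF this]
    have "leading_part (monomial_degree n) (monomial_subst f n) (monomial_subst mpoly_var n)"
      unfolding monomial_subst_def monomial_degree_def by (intro leading_part_prod) simp
    then show ?thesis
      by (simp add: monomial_subst_var)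
  qed
  \<comment> \<open>The error terms have degree above that of \<open>n\<close>, hence above that of
    \<open>m\<close>, so they cannot contain \<open>m\<close>. This also covers other monomials of
    the same least degree.\<close>
  have coeff: "Poly_Mapping.lookup (monomial_subst f n) m = (1 when n = m)" if "n \<in> ?K" for n
  proof -
    have "m \<notin> Poly_Mapping.keys (monomial_subst f n - Poly_Mapping.single n 1)"
      using lead[of n] least[OF that] by (force simp: leading_part_def order_ge_def)
    then show ?thesis
      by (simp add: in_keys_iff lookup_minus lookup_single)
  qed
  have scale: "Poly_Mapping.lookup (mpoly_const c * q) m = c * Poly_Mapping.lookup q m"
    for c and q :: "('w, 'a) mpoly"
    by (simp add: mpoly_const_def lookup_mult lookup_single when_mult mult_when)
  have "Poly_Mapping.lookup (mpoly_subst f p) m =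
      (\<Sum>n\<in>?K. Poly_Mapping.lookup p n * Poly_Mapping.lookup (monomial_subst f n) m)"
    by (simp add: mpoly_subst_eq_sum[of ?K] lookup_sum scale)
  also have "\<dots> = (\<Sum>n\<in>?K. if n = m then Poly_Mapping.lookup p n else 0)"
    by (intro sum.cong refl) (simp add: coeff)
  also have "\<dots> = Poly_Mapping.lookup p m"
    using m by simp
  finally show False
    using zero m by (simp add: in_keys_iff)
qed

text \<open>Applying \<open>e\<close> to a relation p(f) = 0 gives the same relation
  \<open>p\<close> for the substituted family.\<close>

lemma algebraically_independent_of_subst:
  assumes "algebraically_independent (\<lambda>i. mpoly_subst e (f i))"
  shows "algebraically_independent f"
  using assms unfolding algebraically_independent_def
  by (metis mpoly_subst_mpoly_subst mpoly_subst_0)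

section \<open>Linear algebra and the change of variables\<close>

text \<open>The vectors \<open>h i\<close> are the rows of a matrix, and a matrix with independent
  rows has a right inverse. Its entries will be the coefficients of the linear substitution.\<close>

lemma linearly_independent_family_right_inverse:
  fixes h :: "'l::finite \<Rightarrow> 'a::field ^ 's::finite"
  assumes "linearly_independent_family h"
  obtains B :: "'a ^ 'l ^ 's" where "\<And>i k. (\<Sum>j\<in>UNIV. h i $ j * B $ j $ k) = (if i = k then 1 else 0)"
proof -
  define A :: "'a ^ 's ^ 'l" where "A = (\<chi> i. h i)"
  have inj: "inj h" and indep: "vec.independent (range h)"
    using assms by (auto simp: linearly_independent_family_def)
  have "\<forall>i. c i = 0" if c: "(\<Sum>i\<in>UNIV. c i *s row i A) = 0" for c
  proof -
    \<comment> \<open>A relation indexed by \<open>i\<close> becomes one over the set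
      \<open>range h\<close>, with \<open>inv h\<close> recovering the index by injectivity.\<close>
    have "(\<Sum>v\<in>range h. c (inv h v) *s v) = (\<Sum>i\<in>UNIV. c i *s h i)"
      using inj by (simp add: sum.reindex)
    also have "\<dots> = 0"
      using c by (simp add: A_def row_def)
    finally have "c (inv h (h i)) = 0" for i
      using vec.independentD[OF indep, of "range h" "\<lambda>v. c (inv h v)" "h i"] by simp
    then show ?thesis
      using inj by simp
  qed
  then have "\<exists>B :: 'a ^ 'l ^ 's. A ** B = mat 1"
    unfolding matrix_right_invertible_independent_rows by simp
  then obtain B :: "'a ^ 'l ^ 's" where "A ** B = mat 1" ..
  then have "(A ** B) $ i $ k = mat 1 $ i $ k" for i k
    by simp
  then have "(\<Sum>j\<in>UNIV. h i $ j * B $ j $ k) = (if i = k then 1 else 0)" for i k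
    by (simp add: A_def matrix_matrix_mult_def mat_def)
  then show thesis
    by (rule that)
qed

theorem mainTheorem7:
  fixes f g :: "'l::finite \<Rightarrow> ('s::finite, 'a::alg_closed_field) mpoly"
    and h :: "'l \<Rightarrow> 'a ^ 's"
  assumes f_form: "\<And>i. f i = (\<Sum>j\<in>UNIV. mpoly_const (h i $ j) * mpoly_var j) + g i"
    and g_terms: "\<And>i m. m \<in> Poly_Mapping.keys (g i) \<Longrightarrow> 2 \<le> monomial_degree m"
    and h_indep: "linearly_independent_family h"
  shows "algebraically_independent f"
proof -
  obtain B :: "'a ^ 'l ^ 's"
    where B: "\<And>i k. (\<Sum>j\<in>UNIV. h i $ j * B $ j $ k) = (if i = k then 1 else 0)"
    using linearly_independent_family_right_inverse[OF h_indep] by blast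
  \<comment> \<open>Linear forms in new variables, one for each \<open>f i\<close>, chosen so that
    the linear part of \<open>f i\<close> turns into the \<open>i\<close>-th new variable.\<close>
  define e :: "'s \<Rightarrow> ('l, 'a) mpoly"
    where "e j = (\<Sum>k\<in>UNIV. mpoly_const (B $ j $ k) * mpoly_var k)" for j
  \<comment> \<open>Without constant terms in \<open>e\<close>, the substituted \<open>g i\<close>
    still has order at least 2.\<close>
  have "order_ge 1 (e j)" for j
    unfolding e_def by (intro order_ge_sum order_ge_mult_left order_ge_var)
  then have g: "order_ge 2 (mpoly_subst e (g i))" for i
    using g_terms by (intro order_ge_mpoly_subst) (auto simp: order_ge_def)
  have "mpoly_subst e (f i) - mpoly_var i = mpoly_subst e (g i)" for i
  proof -
    have "(\<Sum>j\<in>UNIV. mpoly_const (h i $ j) * e j) =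
        (\<Sum>j\<in>UNIV. \<Sum>k\<in>UNIV. mpoly_const (h i $ j * B $ j $ k) * mpoly_var k)"
      by (simp add: e_def sum_distrib_left mpoly_const_mult mult.assoc)
    \<comment> \<open>Interchanging the sums exposes the entries of the product of \<open>h\<close>
      and \<open>B\<close>, which is the identity matrix.\<close>
    also have "\<dots> = (\<Sum>k\<in>UNIV. mpoly_const (\<Sum>j\<in>UNIV. h i $ j * B $ j $ k) * mpoly_var k)"
      by (subst sum.swap) (simp add: mpoly_const_sum sum_distrib_right)
    also have "\<dots> = (\<Sum>k\<in>UNIV. if i = k then mpoly_var k else 0)"
      by (intro sum.cong refl) (simp add: B)
    also have "\<dots> = mpoly_var i"
      by simp
    finally show ?thesis
      by (simp add: f_form mpoly_subst_add mpoly_subst_sum mpoly_subst_mult mpoly_subst_const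
          mpoly_subst_var)
  qed
  with g have "order_ge 2 (mpoly_subst e (f i) - mpoly_var i)" for i
    by simp
  then show ?thesis
    by (intro algebraically_independent_of_subst[of e] algebraically_independent_of_leading_vars)
qed

end
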